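(* Let $\widehat E=E+\varepsilon E_0$ and $\widehat F=F+\varepsilon F_0$ be dual matrices in $\mathbb{D}^{m\times n}$ whose dual Moore-Penrose generalized inverses (DMPGIs) exist. Then $\widehat E\overset{{\rm P}\text{-}\ast}{\leq}\widehat F$ (P-star partial order) if and only if $\widehat E\overset{\rm D}{\leq}\widehat F$ (Dual-minus partial order) and $$EF^{T}=(EF^{T})^{T},\quad F^{T}E=(F^{T}E)^{T},\quad EE^\dagger(F_0-E_0)=O,\quad (F_0-E_0)E^\dagger E=O.$$
   Context: $\varepsilon$ is the dual unit: $\varepsilon\neq 0$, $\varepsilon^2=0$, commuting with reals. $\mathbb{D}^{m\times n}$ is the set of $m\times n$ dual matrices $\widehat E=E+\varepsilon E_0$ with $E,E_0\in\mathbb{R}^{m\times n}$, with the obvious addition, multiplication and transpose $\widehat E^{T}=E^T+\varepsilon E_0^T$. The DMPGI of $\widehat E\in\mathbb{D}^{m\times n}$ is the unique $\widehat X\in\mathbb{D}^{n\times m}$, if it exists, with $\widehat E\widehat X\widehat E=\widehat E$, $\widehat X\widehat E\widehat X=\widehat X$, $(\widehat E\widehat X)^T=\widehat E\widehat X$, $(\widehat X\widehat E)^T=\widehat X\widehat E$. For a real matrix $E$, $E^\dagger$ is the usual Moore-Penrose inverse. The Moore-Penrose dual generalized inverse of $\widehat E$ (which always exists) is $\widehat E^{p}=E^\dagger-\varepsilon E^\dagger E_0E^\dagger$. Minus partial order on real matrices of the same size: $E\leq F$ means $\mathrm{rk}(F-E)=\mathrm{rk}(F)-\mathrm{rk}(E)$.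 For $\widehat E,\widehat F\in\mathbb{D}^{m\times n}$ whose DMPGIs exist: (i) Dual-minus partial order: $\widehat E\overset{\rm D}{\leq}\widehat F$ means that $E\leq F$ and the DMPGI of $\widehat F-\widehat E$ exists. (ii) P-star partial order: $\widehat E\overset{{\rm P}\text{-}\ast}{\leq}\widehat F$ means $\widehat E^{p}\widehat E=\widehat E^{p}\widehat F$ and $\widehat E\widehat E^{p}=\widehat F\widehat E^{p}$. *)

theory Defs
  imports "HOL-Analysis.Analysis"
begin

datatype dual = Dual (std: real) (inf_part: real)

instantiation dual :: comm_ring_1
begin

definition zero_dual :: dual where "0 = Dual 0 0"
definition one_dual :: dual where "1 = Dual 1 0"
definition plus_dual :: "dual \<Rightarrow> dual \<Rightarrow> dual" where
  "x + y = Dual (std x + std y) (inf_part x + inf_part y)"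
definition uminus_dual :: "dual \<Rightarrow> dual" where
  "- x = Dual (- std x) (- inf_part x)"
definition minus_dual :: "dual \<Rightarrow> dual \<Rightarrow> dual" where
  "x - y = Dual (std x - std y) (inf_part x - inf_part y)"
definition times_dual :: "dual \<Rightarrow> dual \<Rightarrow> dual" where
  "x * y = Dual (std x * std y) (std x * inf_part y + inf_part x * std y)"

instance
  by standard
    (auto simp: zero_dual_def one_dual_def plus_dual_def uminus_dual_def minus_dual_def
      times_dual_def algebra_simps intro: dual.expand)

end

definition dual_unit :: dual where "dual_unit = Dual 0 1"

lemma dual_unit_neq_0: "dual_unit \<noteq> 0"
  by (simp add: dual_unit_def zero_dual_def)

lemma dual_unit_square: "dual_unit ^ 2 = 0"
  by (simp add: dual_unit_def zero_dual_def times_dual_def power2_eq_square)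

lemma Dual_conv_dual_unit: "Dual a b = Dual a 0 + dual_unit * Dual b 0"
  by (simp add: dual_unit_def plus_dual_def times_dual_def)

(* dual_matrix E E0 is the matrix E + epsilon E0; dual matrices are the matrices over the ring
   of dual numbers, so that sum, product and transpose are the ones of the library. *)
definition dual_matrix :: "real^'n^'m \<Rightarrow> real^'n^'m \<Rightarrow> dual^'n^'m" where
  "dual_matrix E E0 = (\<chi> i j. Dual (E $ i $ j) (E0 $ i $ j))"

definition std_matrix :: "dual^'n^'m \<Rightarrow> real^'n^'m" where
  "std_matrix A = map_matrix std A"

definition inf_matrix :: "dual^'n^'m \<Rightarrow> real^'n^'m" where
  "inf_matrix A = map_matrix inf_part A"

lemma std_matrix_dual_matrix [simp]: "std_matrix (dual_matrix E E0) = E"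
  by (simp add: std_matrix_def dual_matrix_def vec_eq_iff)

lemma inf_matrix_dual_matrix [simp]: "inf_matrix (dual_matrix E E0) = E0"
  by (simp add: inf_matrix_def dual_matrix_def vec_eq_iff)

definition is_mp_inverse :: "'a::comm_ring_1^'n^'m \<Rightarrow> 'a^'m^'n \<Rightarrow> bool" where
  "is_mp_inverse A X \<longleftrightarrow>
     A ** X ** A = A \<and> X ** A ** X = X \<and>
     transpose (A ** X) = A ** X \<and> transpose (X ** A) = X ** A"

lemma is_mp_inverse_unique:
  assumes X: "is_mp_inverse A X" and Y: "is_mp_inverse A Y"
  shows "X = Y"
proof -
  have "A ** X = (A ** Y) ** (A ** X)"
    using Y by (metis is_mp_inverse_def matrix_mul_assoc)
  also have "\<dots> = transpose ((A ** X) ** (A ** Y))"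
    using X Y by (simp add: is_mp_inverse_def matrix_transpose_mul)
  also have "\<dots> = A ** Y"
    using X Y by (metis is_mp_inverse_def matrix_mul_assoc)
  finally have 1: "A ** X = A ** Y" .
  have "X ** A = (X ** A) ** (Y ** A)"
    using Y by (metis is_mp_inverse_def matrix_mul_assoc)
  also have "\<dots> = transpose ((Y ** A) ** (X ** A))"
    using X Y by (simp add: is_mp_inverse_def matrix_transpose_mul)
  also have "\<dots> = Y ** A"
    using X Y by (metis is_mp_inverse_def matrix_mul_assoc)
  finally have 2: "X ** A = Y ** A" .
  show ?thesis
    using X Y 1 2 by (metis is_mp_inverse_def matrix_mul_assoc)
qed

(* By is_mp_inverse_unique, existence here is the same as unique existence. *)
definition dmpgi_exists :: "dual^'n^'m \<Rightarrow> bool" where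
  "dmpgi_exists A \<longleftrightarrow> (\<exists>X. is_mp_inverse A X)"

definition pinv :: "real^'n^'m \<Rightarrow> real^'m^'n" where
  "pinv E = (THE X. is_mp_inverse E X)"

(* The Moore-Penrose dual generalized inverse, defined for every dual matrix; in general it is
   not a Moore-Penrose inverse in the sense of is_mp_inverse. *)
definition mpdgi :: "dual^'n^'m \<Rightarrow> dual^'m^'n" where
  "mpdgi A = (let P = pinv (std_matrix A) in dual_matrix P (- (P ** inf_matrix A ** P)))"

(* The subtraction takes place in the integers, as it would be truncated on nat. *)
definition minus_le :: "real^'n^'m \<Rightarrow> real^'n^'m \<Rightarrow> bool" where
  "minus_le E F \<longleftrightarrow> int (rank (F - E)) = int (rank F) - int (rank E)"

(* The two relations below are partial orders on the dual matrices satisfying dmpgi_exists;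
   that domain condition is left to the statements using them. *)
definition dual_minus_le :: "dual^'n^'m \<Rightarrow> dual^'n^'m \<Rightarrow> bool" where
  "dual_minus_le A B \<longleftrightarrow> minus_le (std_matrix A) (std_matrix B) \<and> dmpgi_exists (B - A)"

definition p_star_le :: "dual^'n^'m \<Rightarrow> dual^'n^'m \<Rightarrow> bool" where
  "p_star_le A B \<longleftrightarrow> mpdgi A ** A = mpdgi A ** B \<and> A ** mpdgi A = B ** mpdgi A"

end

theory Submission
  imports Defs
begin

text \<open>
  Write \<open>D = F - E\<close>, \<open>D0 = F0 - E0\<close>, and \<open>P\<close>, \<open>Q\<close> for the Moore-Penrose inverses of \<open>E\<close>, \<open>F\<close>.
  Separating standard and infinitesimal parts, the P-star order says \<open>P D = 0\<close>, \<open>D P = 0\<close>,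
  \<open>P D0 = 0\<close>, \<open>D0 P = 0\<close>, where the last two equations are equivalent to \<open>E P D0 = 0\<close>, \<open>D0 P E = 0\<close>.
  The first two equations make the ranges of \<open>E\<close> and \<open>D\<close> independent, whence the minus order, and
  make \<open>Q - P\<close> the Moore-Penrose inverse of \<open>D\<close>; the dual inverse of \<open>D + \<epsilon> D0\<close> then exists by the
  criterion that \<open>A + \<epsilon> A0\<close> has one iff \<open>(1 - A A\<^sup>\<dagger>) A0 (1 - A\<^sup>\<dagger> A) = 0\<close>.
  Conversely, the minus order gives \<open>F Q E = E\<close> and \<open>E Q E = E\<close>, and then symmetry of \<open>F\<^sup>T E\<close> yields
  \<open>E\<^sup>T E = E\<^sup>T F Q E = F\<^sup>T E Q E = F\<^sup>T E = E\<^sup>T F\<close>, that is \<open>E\<^sup>T D = 0\<close>; transposing gives \<open>D E\<^sup>T = 0\<close>.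
\<close>

section \<open>Arithmetic of real and dual matrices\<close>

lemma matrix_add_rdistrib: "(B + C) ** A = B ** A + C ** (A :: 'a::semiring_1^'n^'m)"
  by (vector matrix_matrix_mult_def sum.distrib distrib_right)

lemma matrix_diff_ldistrib: "A ** (B - C) = A ** B - A ** (C :: 'a::ring_1^'n^'m)"
  by (simp add: vec_eq_iff matrix_matrix_mult_def sum_subtractf algebra_simps)

lemma matrix_diff_rdistrib: "(B - C) ** A = B ** A - C ** (A :: 'a::ring_1^'n^'m)"
  by (simp add: vec_eq_iff matrix_matrix_mult_def sum_subtractf algebra_simps)

lemma matrix_minus_mult: "(- A) ** B = - (A ** (B :: 'a::ring_1^'n^'m))"
  by (simp add: vec_eq_iff matrix_matrix_mult_def sum_negf)

lemma matrix_mult_minus: "A ** (- B) = - (A ** (B :: 'a::ring_1^'n^'m))"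
  by (simp add: vec_eq_iff matrix_matrix_mult_def sum_negf)

lemma transpose_add: "transpose (A + B) = transpose A + transpose B"
  by (simp add: vec_eq_iff transpose_def)

lemma transpose_diff: "transpose (A - B) = transpose A - transpose B"
  by (simp add: vec_eq_iff transpose_def)

lemma transpose_minus: "transpose (- A) = - transpose A"
  by (simp add: vec_eq_iff transpose_def)

lemmas matrix_expand =
  matrix_add_ldistrib matrix_add_rdistrib matrix_diff_ldistrib matrix_diff_rdistrib
  matrix_minus_mult matrix_mult_minus
  transpose_add transpose_diff transpose_minus matrix_transpose_mul

lemma dual_matrix_std_inf: "dual_matrix (std_matrix A) (inf_matrix A) = A"
  by (simp add: vec_eq_iff dual_matrix_def std_matrix_def inf_matrix_def)

lemma dual_matrix_eq_iff: "dual_matrix A A0 = dual_matrix B B0 \<longleftrightarrow> A = B \<and> A0 = B0"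
  by (metis std_matrix_dual_matrix inf_matrix_dual_matrix)

lemma dual_matrix_diff: "dual_matrix A A0 - dual_matrix B B0 = dual_matrix (A - B) (A0 - B0)"
  by (simp add: vec_eq_iff dual_matrix_def minus_dual_def)

lemma sum_Dual: "(\<Sum>k\<in>S. Dual (f k) (g k)) = Dual (sum f S) (sum g S)"
  by (induction S rule: infinite_finite_induct) (auto simp: zero_dual_def plus_dual_def)

lemma dual_matrix_mult:
  "dual_matrix A A0 ** dual_matrix B B0 = dual_matrix (A ** B) (A ** B0 + A0 ** B)"
  by (simp add: vec_eq_iff matrix_matrix_mult_def dual_matrix_def times_dual_def sum_Dual
      sum.distrib)

lemma transpose_dual_matrix:
  "transpose (dual_matrix A A0) = dual_matrix (transpose A) (transpose A0)"
  by (simp add: vec_eq_iff transpose_def dual_matrix_def)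

section \<open>Calculation with Moore-Penrose inverses\<close>

lemma is_mp_inverse_pinv:
  assumes "is_mp_inverse A X"
  shows "pinv A = X"
  unfolding pinv_def using assms is_mp_inverse_unique by blast

text \<open>These serve as rewrite rules for right-nested products: the \<open>_assoc\<close> forms
  carry a trailing factor, so that a redex inside a longer product is found too, and the
  \<open>sym\<close> forms remove transposes.\<close>

lemma
  assumes "is_mp_inverse A X"
  shows mp_inverse_inner: "A ** (X ** A) = A"
    and mp_inverse_inner_assoc: "A ** (X ** (A ** Z)) = A ** Z"
    and mp_inverse_outer: "X ** (A ** X) = X"
    and mp_inverse_outer_assoc: "X ** (A ** (X ** Z')) = X ** Z'"
    and mp_inverse_sym_left: "transpose X ** transpose A = A ** X"
    and mp_inverse_sym_left_assoc: "transpose X ** (transpose A ** W) = A ** (X ** W)"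
    and mp_inverse_sym_right: "transpose A ** transpose X = X ** A"
    and mp_inverse_sym_right_assoc: "transpose A ** (transpose X ** W') = X ** (A ** W')"
  using assms
  by (simp_all add: is_mp_inverse_def flip: matrix_transpose_mul)
     (simp_all add: is_mp_inverse_def matrix_mul_assoc flip: matrix_transpose_mul)

text \<open>Transpose \<open>X = X ** A ** X\<close> and use that \<open>A ** X\<close>,
  respectively \<open>X ** A\<close>, is symmetric.\<close>

lemma
  assumes "is_mp_inverse A X"
  shows mp_inverse_absorb_left: "A ** (X ** transpose X) = transpose X"
    and mp_inverse_absorb_left_assoc: "A ** (X ** (transpose X ** Z)) = transpose X ** Z"
    and mp_inverse_absorb_right: "transpose X ** (X ** A) = transpose X"
proof -
  show *: "A ** (X ** transpose X) = transpose X" "transpose X ** (X ** A) = transpose X"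
    using assms unfolding is_mp_inverse_def by (metis matrix_mul_assoc matrix_transpose_mul)+
  show "A ** (X ** (transpose X ** Z)) = transpose X ** Z"
    using *(1) by (metis matrix_mul_assoc)
qed

lemmas mp_inverse_simps =
  mp_inverse_absorb_left mp_inverse_absorb_left_assoc mp_inverse_absorb_right
  mp_inverse_inner mp_inverse_inner_assoc mp_inverse_outer mp_inverse_outer_assoc
  mp_inverse_sym_left mp_inverse_sym_left_assoc mp_inverse_sym_right mp_inverse_sym_right_assoc

section \<open>Existence of dual Moore-Penrose inverses\<close>

lemma is_mp_inverse_dual_std:
  assumes "is_mp_inverse (dual_matrix A A0) X"
  shows "is_mp_inverse A (std_matrix X)"
proof -
  define X1 X0 where "X1 = std_matrix X" and "X0 = inf_matrix X"
  have "X = dual_matrix X1 X0"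
    by (simp add: X1_def X0_def dual_matrix_std_inf)
  with assms show ?thesis
    unfolding X1_def [symmetric]
    by (simp add: is_mp_inverse_def dual_matrix_mult transpose_dual_matrix dual_matrix_eq_iff)
qed

lemma dmpgi_exists_iff:
  fixes A A0 :: "real^'n^'m"
  assumes X: "is_mp_inverse A X"
  shows "dmpgi_exists (dual_matrix A A0) \<longleftrightarrow> (mat 1 - A ** X) ** A0 ** (mat 1 - X ** A) = 0"
proof
  assume "dmpgi_exists (dual_matrix A A0)"
  then obtain Y where Y: "is_mp_inverse (dual_matrix A A0) Y"
    unfolding dmpgi_exists_def by blast
  have "std_matrix Y = X"
    using is_mp_inverse_dual_std [OF Y] X is_mp_inverse_unique by blast
  then have "Y = dual_matrix X (inf_matrix Y)"
    by (metis dual_matrix_std_inf)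
  with Y have *: "A ** X ** A0 + (A ** inf_matrix Y + A0 ** X) ** A = A0"
    by (metis is_mp_inverse_def dual_matrix_mult dual_matrix_eq_iff)
  \<comment> \<open>Each summand starts or ends with \<open>A\<close>, and the outer factors
    annihilate \<open>A\<close> from the left and from the right.\<close>
  have "(mat 1 - A ** X) ** (A ** X ** A0 + (A ** inf_matrix Y + A0 ** X) ** A)
      ** (mat 1 - X ** A) = 0"
    by (simp add: matrix_expand mp_inverse_simps [OF X] flip: matrix_mul_assoc)
  then show "(mat 1 - A ** X) ** A0 ** (mat 1 - X ** A) = 0"
    unfolding * .
next
  assume 0: "(mat 1 - A ** X) ** A0 ** (mat 1 - X ** A) = 0"
  \<comment> \<open>The first two terms use that \<open>X X\<^sup>T\<close> and \<open>X\<^sup>T X\<close> are the Moore-Penrose inverses of \<open>A\<^sup>T A\<close> and \<open>A A\<^sup>T\<close>.\<close>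
  define X0 where "X0 = X ** transpose X ** transpose A0 ** (mat 1 - A ** X)
    + (mat 1 - X ** A) ** transpose A0 ** transpose X ** X - X ** A0 ** X"
  \<comment> \<open>The criterion solved for \<open>A0\<close>: its right-hand side is what the
    infinitesimal part of the first Penrose equation reduces to.\<close>
  have A0: "A0 = A ** (X ** A0) + A0 ** (X ** A) - A ** (X ** (A0 ** (X ** A)))"
    using 0 by (simp add: matrix_expand algebra_simps flip: matrix_mul_assoc)
  have "is_mp_inverse (dual_matrix A A0) (dual_matrix X X0)"
    unfolding is_mp_inverse_def dual_matrix_mult transpose_dual_matrix dual_matrix_eq_iff
  proof (intro conjI)
    show "A ** X ** A0 + (A ** X0 + A0 ** X) ** A = A0"
    proof -
      have "A ** X ** A0 + (A ** X0 + A0 ** X) ** A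
          = A ** (X ** A0) + A0 ** (X ** A) - A ** (X ** (A0 ** (X ** A)))"
        by (simp add: X0_def matrix_expand mp_inverse_simps [OF X] algebra_simps
            flip: matrix_mul_assoc)
      then show ?thesis
        using A0 by simp
    qed
  qed (simp_all add: X0_def matrix_expand mp_inverse_simps [OF X] algebra_simps
      flip: matrix_mul_assoc)
  then show "dmpgi_exists (dual_matrix A A0)"
    unfolding dmpgi_exists_def by blast
qed

section \<open>Transposition, rank additivity and the minus order\<close>

lemma is_mp_inverse_transpose:
  assumes "is_mp_inverse A X"
  shows "is_mp_inverse (transpose A) (transpose X)"
  using assms unfolding is_mp_inverse_def
  by (metis matrix_mul_assoc matrix_transpose_mul)

text \<open>The sum \<open>S\<close> of the two ranges contains the range of \<open>A + B\<close>,
  and its dimension is \<open>rank A + rank B\<close> minus that of the intersection. So ranks add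
  iff the intersection is trivial and \<open>S\<close> is the range of \<open>A + B\<close>; the
  latter holds once that range contains the range of \<open>A\<close>.\<close>

lemma rank_add_iff:
  fixes A B :: "real^'n^'m"
  shows "rank (A + B) = rank A + rank B \<longleftrightarrow>
    range ((*v) A) \<inter> range ((*v) B) \<subseteq> {0} \<and> range ((*v) A) \<subseteq> range ((*v) (A + B))"
proof -
  define S where "S = {x + y |x y. x \<in> range ((*v) A) \<and> y \<in> range ((*v) B)}"
  have sub: "subspace (range ((*v) C))" for C :: "real^'n^'m"
    by (intro linear_subspace_image matrix_vector_mul_linear subspace_UNIV)
  have S: "subspace S"
    unfolding S_def by (intro subspace_sums sub)
  have le: "range ((*v) (A + B)) \<subseteq> S"
    by (auto simp: S_def matrix_vector_mult_add_rdistrib)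
  have dim: "dim S + dim (range ((*v) A) \<inter> range ((*v) B)) = rank A + rank B"
    unfolding S_def rank_dim_range by (intro dim_sums_Int sub)
  have AS: "range ((*v) A) \<subseteq> S"
    unfolding S_def by (smt (verit) add_0_right image_subset_iff matrix_vector_mult_0_right
        mem_Collect_eq range_eqI)
  have SI: "S \<subseteq> range ((*v) (A + B))" if "range ((*v) A) \<subseteq> range ((*v) (A + B))"
  proof -
    have "B *v y \<in> range ((*v) (A + B))" for y
    proof -
      have "B *v y = (A + B) *v y - A *v y"
        by (simp add: matrix_vector_mult_add_rdistrib)
      then show ?thesis
        using that subspace_diff [OF sub] by (metis range_subsetD rangeI)
    qed
    then show ?thesis
      using that subspace_add [OF sub] unfolding S_def by blast
  qed
  show ?thesis
  proof
    assume r: "rank (A + B) = rank A + rank B"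
    have *: "dim (range ((*v) (A + B))) \<le> dim S"
      using le by (rule dim_subset)
    then have "dim (range ((*v) A) \<inter> range ((*v) B)) = 0"
      using dim r unfolding rank_dim_range by linarith
    moreover have "range ((*v) (A + B)) = S"
      using * dim r by (intro subspace_dim_equal sub S le) (simp add: rank_dim_range)
    ultimately show "range ((*v) A) \<inter> range ((*v) B) \<subseteq> {0} \<and>
        range ((*v) A) \<subseteq> range ((*v) (A + B))"
      using AS by simp
  next
    assume r: "range ((*v) A) \<inter> range ((*v) B) \<subseteq> {0} \<and> range ((*v) A) \<subseteq> range ((*v) (A + B))"
    then have "range ((*v) (A + B)) = S"
      using SI le by blast
    moreover have "dim (range ((*v) A) \<inter> range ((*v) B)) = 0"
      using r by simp
    ultimately show "rank (A + B) = rank A + rank B"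
      by (metis add.right_neutral dim rank_dim_range)
  qed
qed

lemma minus_le_iff:
  "minus_le E F \<longleftrightarrow>
    range ((*v) E) \<inter> range ((*v) (F - E)) \<subseteq> {0} \<and> range ((*v) E) \<subseteq> range ((*v) F)"
  using rank_add_iff [of E "F - E"] by (auto simp: minus_le_def)

lemma minus_le_transpose:
  assumes "minus_le E F"
  shows "minus_le (transpose E) (transpose F)"
  using assms by (simp add: minus_le_def rank_transpose flip: transpose_diff)

text \<open>\<open>F ** Q\<close> fixes the range of \<open>F\<close>, which contains that of
  \<open>E\<close>.\<close>

lemma minus_le_mult_left:
  assumes le: "minus_le E F" and Q: "is_mp_inverse F Q"
  shows "F ** Q ** E = E"
proof -
  have "(F ** Q ** E) *v x = E *v x" for x
  proof -
    obtain y where y: "E *v x = F *v y"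
      using le unfolding minus_le_iff by blast
    have "(F ** Q ** E) *v x = (F ** Q ** F) *v y"
      by (simp add: y flip: matrix_vector_mul_assoc)
    then show ?thesis
      using Q y by (simp add: is_mp_inverse_def)
  qed
  then show ?thesis
    by (simp add: matrix_eq)
qed

lemma minus_le_mult_middle:
  assumes le: "minus_le E F" and Q: "is_mp_inverse F Q"
  shows "E ** Q ** E = E"
proof -
  have "(E ** Q ** E) *v x = E *v x" for x
  proof -
    \<comment> \<open>This vector lies in the ranges of both \<open>E\<close> and
      \<open>F - E\<close>, hence vanishes.\<close>
    have "E *v (x - (Q ** E) *v x) = (F ** Q ** E) *v x - (E ** Q ** E) *v x"
      using minus_le_mult_left [OF le Q]
      by (simp add: matrix_vector_mult_diff_distrib matrix_vector_mul_assoc matrix_mul_assoc)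
    also have "\<dots> = (F - E) *v ((Q ** E) *v x)"
      by (simp add: matrix_vector_mult_diff_rdistrib flip: matrix_vector_mul_assoc)
    finally have "E *v (x - (Q ** E) *v x) = 0"
      using le unfolding minus_le_iff by blast
    then show ?thesis
      by (simp add: matrix_vector_mult_diff_distrib matrix_vector_mul_assoc matrix_mul_assoc)
  qed
  then show ?thesis
    by (simp add: matrix_eq)
qed

lemma minus_le_sym_imp_orthogonal:
  assumes le: "minus_le E F" and Q: "is_mp_inverse F Q"
    and sym: "transpose F ** E = transpose (transpose F ** E)"
  shows "transpose E ** (F - E) = 0"
proof -
  have sym': "transpose F ** E = transpose E ** F"
    using sym by (simp add: matrix_transpose_mul)
  have "transpose E ** E = transpose E ** F ** Q ** E"
    by (metis minus_le_mult_left [OF le Q] matrix_mul_assoc)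
  also have "\<dots> = transpose F ** E"
    by (metis minus_le_mult_middle [OF le Q] matrix_mul_assoc sym')
  finally show ?thesis
    by (simp add: matrix_diff_ldistrib sym')
qed

text \<open>Symmetry of \<open>E ** P\<close> in \<open>P = P ** E ** P\<close> exhibits
  \<open>transpose E\<close> as a right factor of \<open>P\<close>.\<close>

lemma mp_inverse_mult_eq_0:
  assumes "is_mp_inverse E P" and "transpose E ** D = 0"
  shows "P ** D = 0"
proof -
  have "P = P ** transpose P ** transpose E"
    using assms by (simp add: mp_inverse_simps flip: matrix_mul_assoc)
  then show ?thesis
    by (metis assms(2) matrix_mul_assoc times0_right)
qed

lemma minus_le_sym_imp_star:
  assumes le: "minus_le E F" and P: "is_mp_inverse E P" and Q: "is_mp_inverse F Q"
    and sym1: "E ** transpose F = transpose (E ** transpose F)"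
    and sym2: "transpose F ** E = transpose (transpose F ** E)"
  shows "P ** (F - E) = 0" and "(F - E) ** P = 0"
proof -
  show "P ** (F - E) = 0"
    using minus_le_sym_imp_orthogonal [OF le Q sym2] by (rule mp_inverse_mult_eq_0 [OF P])
  \<comment> \<open>The second claim is the first one for the transposed matrices.\<close>
  have "transpose (transpose E) ** (transpose F - transpose E) = 0"
    by (rule minus_le_sym_imp_orthogonal
        [OF minus_le_transpose [OF le] is_mp_inverse_transpose [OF Q]])
      (metis sym1 matrix_transpose_mul)
  then have "transpose P ** transpose (F - E) = 0"
    using mp_inverse_mult_eq_0 [OF is_mp_inverse_transpose [OF P]] by (simp add: transpose_diff)
  then have "transpose ((F - E) ** P) = transpose 0"
    by (simp add: matrix_transpose_mul) (simp add: transpose_def vec_eq_iff)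
  then show "(F - E) ** P = 0"
    by simp
qed

section \<open>Consequences of the standard part of the P-star order\<close>

context
  fixes E F :: "real^'n^'m" and P Q :: "real^'m^'n"
  assumes P: "is_mp_inverse E P" and Q: "is_mp_inverse F Q"
    and PD: "P ** (F - E) = 0" and DP: "(F - E) ** P = 0"
begin

lemma star_mult_eq: "P ** F = P ** E" "F ** P = E ** P"
  using PD DP by (simp_all add: matrix_diff_ldistrib matrix_diff_rdistrib)

text \<open>The symmetric projector \<open>E ** P\<close> or \<open>P ** E\<close> is moved from
  \<open>E\<close> onto \<open>F\<close>, where it turns \<open>F\<close> into
  \<open>E\<close>.\<close>

lemma star_imp_sym: "E ** transpose F = E ** transpose E" "transpose F ** E = transpose E ** E"
proof -
  have "transpose F ** E = transpose (E ** P ** F) ** E"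
    using P by (simp add: mp_inverse_simps matrix_transpose_mul flip: matrix_mul_assoc)
  also have "\<dots> = transpose E ** E"
    using P by (simp add: star_mult_eq is_mp_inverse_def flip: matrix_mul_assoc)
  finally show "transpose F ** E = transpose E ** E" .
  have "E ** transpose F = E ** transpose (F ** P ** E)"
    using P by (simp add: mp_inverse_simps matrix_transpose_mul flip: matrix_mul_assoc)
  also have "\<dots> = E ** transpose E"
    using P by (simp add: star_mult_eq is_mp_inverse_def)
  finally show "E ** transpose F = E ** transpose E" .
qed

text \<open>\<open>E ** P\<close> fixes the range of \<open>E\<close> and annihilates that of
  \<open>F - E\<close>; moreover \<open>F ** P ** E = E\<close>.\<close>

lemma star_imp_minus_le: "minus_le E F"
  unfolding minus_le_iff
proof (intro conjI subsetI)
  fix v assume "v \<in> range ((*v) E) \<inter> range ((*v) (F - E))"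
  then obtain x y where v: "v = E *v x" "v = (F - E) *v y"
    by blast
  have "v = (E ** P) *v v"
    using P by (simp add: v(1) matrix_vector_mul_assoc is_mp_inverse_def)
  also have "\<dots> = (E ** (P ** (F - E))) *v y"
    by (simp add: v(2) matrix_vector_mul_assoc matrix_mul_assoc)
  finally show "v \<in> {0}"
    by (simp add: PD)
next
  fix v assume "v \<in> range ((*v) E)"
  then obtain x where v: "v = E *v x"
    by blast
  have "F ** P ** E = E"
    using P by (simp add: star_mult_eq is_mp_inverse_def)
  then have "v = F *v ((P ** E) *v x)"
    by (simp add: v matrix_vector_mul_assoc matrix_mul_assoc)
  then show "v \<in> range ((*v) F)"
    by blast
qed

text \<open>Since \<open>E ** P = F ** P\<close>, the projector \<open>F ** Q\<close> fixes
  \<open>E ** P\<close>. Transposing gives \<open>E ** P ** F ** Q = E ** P\<close>, where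
  \<open>E ** P ** F = E\<close>. The other equation is dual.\<close>

lemma star_mult_pinv: "E ** Q = E ** P" "Q ** E = P ** E"
proof -
  have "F ** Q ** (E ** P) = E ** P"
    using Q by (metis is_mp_inverse_def matrix_mul_assoc star_mult_eq(2))
  then have "transpose (E ** P ** (F ** Q)) = transpose (E ** P)"
    using P Q by (simp add: matrix_transpose_mul [of "E ** P"] is_mp_inverse_def)
  then show "E ** Q = E ** P"
    by (metis P is_mp_inverse_def matrix_mul_assoc star_mult_eq(1) transpose_iff)
  have "P ** E ** (Q ** F) = P ** E"
    using Q by (metis is_mp_inverse_def matrix_mul_assoc star_mult_eq(1))
  then have "transpose (Q ** F ** (P ** E)) = transpose (P ** E)"
    using P Q by (simp add: matrix_transpose_mul [of "Q ** F"] is_mp_inverse_def)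
  then show "Q ** E = P ** E"
    by (metis P is_mp_inverse_def matrix_mul_assoc star_mult_eq(2) transpose_iff)
qed

lemma star_diff_mult:
  "(F - E) ** (Q - P) = F ** Q - E ** P" "(Q - P) ** (F - E) = Q ** F - P ** E"
  by (simp_all add: matrix_expand star_mult_eq star_mult_pinv)

lemma star_is_mp_inverse_diff: "is_mp_inverse (F - E) (Q - P)"
  unfolding is_mp_inverse_def star_diff_mult
proof (intro conjI)
  have "E ** (P ** F) = E" "F ** (Q ** E) = E"
    using P by (simp_all add: star_mult_eq star_mult_pinv is_mp_inverse_def matrix_mul_assoc)
  then show "(F ** Q - E ** P) ** (F - E) = F - E"
    using P Q by (simp add: matrix_expand mp_inverse_simps flip: matrix_mul_assoc)
  have "P ** (E ** Q) = P" "Q ** (F ** P) = P"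
    using P by (simp_all add: star_mult_eq star_mult_pinv is_mp_inverse_def matrix_mul_assoc)
  then show "(Q ** F - P ** E) ** (Q - P) = Q - P"
    using P Q by (simp add: matrix_expand mp_inverse_simps flip: matrix_mul_assoc)
qed (use P Q in \<open>simp_all add: transpose_diff is_mp_inverse_def\<close>)

text \<open>As \<open>P\<close> annihilates \<open>F0 - E0\<close> on both sides, the criterion for
  the difference reduces to the outer factors belonging to \<open>F\<close>. These kill
  \<open>F0\<close> by the criterion for \<open>F\<close>; they also absorb the factors belonging to
  \<open>E\<close>, so they kill \<open>E0\<close>.\<close>

lemma star_dmpgi_exists_diff:
  assumes E0: "dmpgi_exists (dual_matrix E E0)" and F0: "dmpgi_exists (dual_matrix F F0)"
    and PD0: "P ** (F0 - E0) = 0" and D0P: "(F0 - E0) ** P = 0"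
  shows "dmpgi_exists (dual_matrix (F - E) (F0 - E0))"
  unfolding dmpgi_exists_iff [OF star_is_mp_inverse_diff] star_diff_mult
proof -
  have 1: "mat 1 - F ** Q = (mat 1 - F ** Q) ** (mat 1 - E ** P)"
    using Q by (simp add: matrix_expand mp_inverse_simps flip: matrix_mul_assoc star_mult_eq(2))
  have "P ** E ** (Q ** F) = P ** E"
    using Q by (metis is_mp_inverse_def matrix_mul_assoc star_mult_eq(1))
  then have 2: "mat 1 - Q ** F = (mat 1 - P ** E) ** (mat 1 - Q ** F)"
    by (simp add: matrix_expand matrix_mul_assoc)
  have "(mat 1 - F ** Q) ** E0 ** (mat 1 - Q ** F)
      = (mat 1 - F ** Q) ** ((mat 1 - E ** P) ** E0 ** (mat 1 - P ** E)) ** (mat 1 - Q ** F)"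
    by (subst 1, subst 2) (simp add: matrix_mul_assoc)
  also have "\<dots> = 0"
    using E0 by (simp add: dmpgi_exists_iff [OF P])
  finally have "(mat 1 - F ** Q) ** E0 ** (mat 1 - Q ** F) = 0" .
  then have "(mat 1 - F ** Q) ** (F0 - E0) ** (mat 1 - Q ** F) = 0"
    using F0 by (simp add: dmpgi_exists_iff [OF Q] matrix_diff_ldistrib [of _ F0]
        matrix_diff_rdistrib [of "_ ** F0"])
  moreover have "(mat 1 - (F ** Q - E ** P)) ** (F0 - E0) = (mat 1 - F ** Q) ** (F0 - E0)"
    by (simp add: matrix_diff_rdistrib PD0 flip: matrix_mul_assoc)
  moreover have "(F0 - E0) ** (mat 1 - (Q ** F - P ** E)) = (F0 - E0) ** (mat 1 - Q ** F)"
    by (simp add: matrix_diff_ldistrib D0P matrix_mul_assoc)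
  ultimately show "(mat 1 - (F ** Q - E ** P)) ** (F0 - E0) ** (mat 1 - (Q ** F - P ** E)) = 0"
    by (metis matrix_mul_assoc)
qed

end

section \<open>The P-star order in components and the equivalence\<close>

lemma p_star_le_iff:
  assumes P: "is_mp_inverse E P"
  shows "p_star_le (dual_matrix E E0) (dual_matrix F F0) \<longleftrightarrow>
    P ** (F - E) = 0 \<and> (F - E) ** P = 0 \<and> P ** (F0 - E0) = 0 \<and> (F0 - E0) ** P = 0"
proof -
  have 1: "P ** E = P ** F \<longleftrightarrow> P ** (F - E) = 0"
    by (auto simp: matrix_diff_ldistrib)
  have 2: "E ** P = F ** P \<longleftrightarrow> (F - E) ** P = 0"
    by (auto simp: matrix_diff_rdistrib)
  \<comment> \<open>Once the standard parts agree, the terms with \<open>P ** E0 ** P\<close>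
    cancel.\<close>
  have 3: "P ** E0 + - (P ** E0 ** P) ** E = P ** F0 + - (P ** E0 ** P) ** F \<longleftrightarrow>
      P ** (F0 - E0) = 0" if "P ** E = P ** F"
    using that by (auto simp: matrix_diff_ldistrib matrix_minus_mult simp flip: matrix_mul_assoc)
  have 4: "E ** - (P ** E0 ** P) + E0 ** P = F ** - (P ** E0 ** P) + F0 ** P \<longleftrightarrow>
      (F0 - E0) ** P = 0" if "E ** P = F ** P"
    using that by (auto simp: matrix_diff_rdistrib matrix_mult_minus matrix_mul_assoc)
  show ?thesis
    unfolding p_star_le_def mpdgi_def std_matrix_dual_matrix inf_matrix_dual_matrix Let_def
      is_mp_inverse_pinv [OF P] dual_matrix_mult dual_matrix_eq_iff
    using 1 2 3 4 by blast
qed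

theorem theorem3p7:
  fixes E E0 F F0 :: "real^'n^'m"
  assumes "dmpgi_exists (dual_matrix E E0)"
    and "dmpgi_exists (dual_matrix F F0)"
  shows "p_star_le (dual_matrix E E0) (dual_matrix F F0) \<longleftrightarrow>
    dual_minus_le (dual_matrix E E0) (dual_matrix F F0) \<and>
    E ** transpose F = transpose (E ** transpose F) \<and>
    transpose F ** E = transpose (transpose F ** E) \<and>
    E ** pinv E ** (F0 - E0) = 0 \<and>
    (F0 - E0) ** pinv E ** E = 0"
proof -
  obtain P where P: "is_mp_inverse E P"
    using assms(1) is_mp_inverse_dual_std unfolding dmpgi_exists_def by blast
  obtain Q where Q: "is_mp_inverse F Q"
    using assms(2) is_mp_inverse_dual_std unfolding dmpgi_exists_def by blast
  \<comment> \<open>Multiplication by \<open>P\<close> from the left removes \<open>E\<close>, by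
    \<open>P ** E ** P = P\<close>.\<close>
  have 1: "E ** P ** (F0 - E0) = 0 \<longleftrightarrow> P ** (F0 - E0) = 0"
    using P by (metis is_mp_inverse_def matrix_mul_assoc times0_right)
  have 2: "(F0 - E0) ** P ** E = 0 \<longleftrightarrow> (F0 - E0) ** P = 0"
    using P by (metis is_mp_inverse_def matrix_mul_assoc times0_left)
  show ?thesis
    unfolding p_star_le_iff [OF P] is_mp_inverse_pinv [OF P] 1 2 dual_minus_le_def
      std_matrix_dual_matrix dual_matrix_diff
  proof (intro iffI; elim conjE; intro conjI)
    assume *: "P ** (F - E) = 0" "(F - E) ** P = 0"
    show "minus_le E F"
      by (rule star_imp_minus_le [OF P Q *])
    show "E ** transpose F = transpose (E ** transpose F)"
      by (simp add: star_imp_sym [OF P Q *] matrix_transpose_mul)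
    show "transpose F ** E = transpose (transpose F ** E)"
      by (simp add: star_imp_sym [OF P Q *] matrix_transpose_mul)
    assume "P ** (F0 - E0) = 0" "(F0 - E0) ** P = 0"
    then show "dmpgi_exists (dual_matrix (F - E) (F0 - E0))"
      by (rule star_dmpgi_exists_diff [OF P Q * assms])
  qed (use minus_le_sym_imp_star [OF _ P Q] in blast)+
qed

end
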